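(* For any $\varepsilon>0$ and any monotone summable property $\mathcal{P}$ of a class $\mathcal{G}$ of bounded asymptotic dimension, there are constants $r\ge 0$ and $K\ge 0$ such that $\mathcal{P}$ has an $r$-round $\varepsilon$-approximate proof labelling scheme of complexity at most $K$.
   Context: All graphs are finite and simple. Asymptotic dimension. For a graph $G$ and an integer $r\ge1$, $G^r$ is the graph obtained from $G$ by adding edges between any pair of vertices at distance at most $r$ in $G$. The weak diameter of a set $S\subseteq V(G)$ is the maximum distance in $G$ between two vertices of $S$. A monochromatic component of a vertex-colored graph is a connected component of a subgraph induced by one of the color classes. For an integer $d\ge0$, a class $\mathcal{G}$ has asymptotic dimension at most $d$ if there is a function $D:\mathbb{N}\to\mathbb{N}$ such that for every integer $r\ge1$, every $G\in\mathcal{G}$ has a (not necessarily proper) $(d+1)$-coloring of its vertex set such that every monochromatic component of $G^r$ has weak diameter at most $D(r)$ in $G$. The class has bounded asymptotic dimension if it has asymptotic dimension at most $d$ for some integer $d\ge 0$. A property $\mathcal{P}$ of a class $\mathcal{G}$ is an isomorphism-closed class of graphs $\mathcal{P}\subseteq\mathcal{G}$; it is monotone if it is closed under taking (not necessarily induced) subgraphs, and summable if the disjoint union of any two graphs in $\mathcal{P}$ is also in $\mathcal{P}$. A graph $G$ is $\varepsilon$-far from $\mathcal{P}$ if $G\notin\mathcal{P}$ and one needs to modify at least $\varepsilon|E(G)|$ adjacencies of $G$ (replacing edges by non-edges and vice versa, on the vertex set of $G$) in order to obtain a graph in $\mathcal{P}$ (this graph need not be connected). Local certification. The instance graphs $G$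 to be certified are connected, and the vertices of an $n$-vertex instance are assigned distinct but otherwise arbitrary identifiers from $\{1,\dots,\mathrm{poly}(n)\}$ (for some fixed polynomial); instances are considered as labelled by these identifiers, and so are their subgraphs. A proof for $G$ is a function $P:V(G)\to\{0,1\}^*$ (it may depend on the identifiers); its size is the maximum length of a certificate $P(v)$, $v\in V(G)$. A verifier $\mathcal{A}$ is a function taking a (labelled) graph $G$, a proof $P$ for $G$ and a vertex $v\in V(G)$ and returning an element of $\{0,1\}$. Let $B_r(v)$ be the set of vertices at distance at most $r$ from $v$ in $G$, let $G[v,r]$ be the subgraph of $G$ induced by $B_r(v)$, and let $P[v,r]$ be the restriction of $P$ to $B_r(v)$. The verifier $\mathcal{A}$ is local with local horizon at most $r$ if $\mathcal{A}(G,P,v)=\mathcal{A}(G[v,r],P[v,r],v)$ for all $G,P,v$. An $r$-round $\varepsilon$-approximate proof labelling scheme for $\mathcal{P}$ is a pair consisting of a prover, which maps each instance $G\in\mathcal{P}$ to a proof $P_G$ for $G$, and a local verifier $\mathcal{A}$ with local horizon at most $r$, such that: (completeness) if $G\in\mathcal{P}$, then $\mathcal{A}(G,P_G,v)=1$ for every $v\in V(G)$; (soundness) if $G$ is $\varepsilon$-far from $\mathcal{P}$, then for every proof $P'$ for $G$ there is a vertex $v\in V(G)$ with $\mathcal{A}(G,P',v)=0$. The complexity of the scheme is the maximum size of the proof $P_G$ over $n$-vertex instances $G\in\mathcal{P}$ (as a function of $n$); complexity at most $K$ means this is at most $K$ for all $n$. *)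

theory Defs
  imports Complex_Main
    "HOL-Library.Extended_Nat"
    "HOL-Library.FuncSet"
    "HOL-Computational_Algebra.Polynomial"
begin

record 'a graph =
  verts :: "'a set"
  edges :: "'a set set"

(* The graph without vertices is admitted. *)
definition simple_graph :: "'a graph \<Rightarrow> bool" where
  "simple_graph G \<longleftrightarrow>
     finite (verts G) \<and> (\<forall>e\<in>edges G. e \<subseteq> verts G \<and> card e = 2)"

definition subgraph :: "'a graph \<Rightarrow> 'a graph \<Rightarrow> bool" where
  "subgraph H G \<longleftrightarrow>
     simple_graph H \<and> verts H \<subseteq> verts G \<and> edges H \<subseteq> edges G"

definition induced :: "'a graph \<Rightarrow> 'a set \<Rightarrow> 'a graph" where
  "induced G S = \<lparr>verts = verts G \<inter> S, edges = {e \<in> edges G. e \<subseteq> S}\<rparr>"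

definition isomorphic :: "'a graph \<Rightarrow> 'b graph \<Rightarrow> bool" where
  "isomorphic G H \<longleftrightarrow>
     (\<exists>f. bij_betw f (verts G) (verts H) \<and> edges H = (\<lambda>e. f ` e) ` edges G)"

definition graph_union :: "'a graph \<Rightarrow> 'a graph \<Rightarrow> 'a graph" where
  "graph_union G H = \<lparr>verts = verts G \<union> verts H, edges = edges G \<union> edges H\<rparr>"


subsection \<open>Distance, components, powers\<close>

definition walk :: "'a graph \<Rightarrow> 'a \<Rightarrow> 'a list \<Rightarrow> 'a \<Rightarrow> bool" where
  "walk G u xs v \<longleftrightarrow>
     xs \<noteq> [] \<and> set xs \<subseteq> verts G \<and> hd xs = u \<and> last xs = v \<and>
     successively (\<lambda>x y. {x, y} \<in> edges G) xs"

(* The infimum over the empty set is infinity, so vertices in different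
   components are at infinite distance. *)
definition gdist :: "'a graph \<Rightarrow> 'a \<Rightarrow> 'a \<Rightarrow> enat" where
  "gdist G u v = (INF xs\<in>{xs. walk G u xs v}. enat (length xs - 1))"

definition reachable :: "'a graph \<Rightarrow> 'a \<Rightarrow> 'a \<Rightarrow> bool" where
  "reachable G u v \<longleftrightarrow> (\<exists>xs. walk G u xs v)"

definition connected_graph :: "'a graph \<Rightarrow> bool" where
  "connected_graph G \<longleftrightarrow>
     verts G \<noteq> {} \<and> (\<forall>u\<in>verts G. \<forall>v\<in>verts G. reachable G u v)"

(* Components are represented by their vertex sets. *)
definition components_of :: "'a graph \<Rightarrow> 'a set set" where
  "components_of G = {{v. reachable G u v} | u. u \<in> verts G}"

definition graph_power :: "'a graph \<Rightarrow> nat \<Rightarrow> 'a graph" where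
  "graph_power G r =
     \<lparr>verts = verts G,
      edges = edges G \<union>
        {{u, v} | u v. u \<in> verts G \<and> v \<in> verts G \<and> u \<noteq> v \<and> gdist G u v \<le> enat r}\<rparr>"

definition weak_diameter :: "'a graph \<Rightarrow> 'a set \<Rightarrow> enat" where
  "weak_diameter G S = (SUP u\<in>S. SUP v\<in>S. gdist G u v)"


subsection \<open>Classes of graphs and asymptotic dimension\<close>

(* A class of finite graphs is represented by its members with vertices in nat;
   every finite graph is isomorphic to such a graph. *)
definition graph_class :: "nat graph set \<Rightarrow> bool" where
  "graph_class \<G> \<longleftrightarrow> (\<forall>G\<in>\<G>. simple_graph G)"

definition monochromatic_components ::
    "'a graph \<Rightarrow> ('a \<Rightarrow> nat) \<Rightarrow> 'a set set" where
  "monochromatic_components G c = (\<Union>i. components_of (induced G {v. c v = i}))"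

definition asymptotic_dim_at_most :: "nat graph set \<Rightarrow> nat \<Rightarrow> bool" where
  "asymptotic_dim_at_most \<G> d \<longleftrightarrow>
     (\<exists>D :: nat \<Rightarrow> nat. \<forall>r\<ge>1. \<forall>G\<in>\<G>.
        \<exists>c. c ` verts G \<subseteq> {..<d + 1} \<and>
            (\<forall>C\<in>monochromatic_components (graph_power G r) c.
               weak_diameter G C \<le> enat (D r)))"

definition bounded_asymptotic_dim :: "nat graph set \<Rightarrow> bool" where
  "bounded_asymptotic_dim \<G> \<longleftrightarrow> (\<exists>d. asymptotic_dim_at_most \<G> d)"

definition graph_property :: "nat graph set \<Rightarrow> nat graph set \<Rightarrow> bool" where
  "graph_property \<P> \<G> \<longleftrightarrow>
     \<P> \<subseteq> \<G> \<and> (\<forall>G\<in>\<P>. \<forall>H. isomorphic G H \<longrightarrow> H \<in> \<P>)"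

definition monotone_property :: "nat graph set \<Rightarrow> bool" where
  "monotone_property \<P> \<longleftrightarrow> (\<forall>G\<in>\<P>. \<forall>H. subgraph H G \<longrightarrow> H \<in> \<P>)"

(* Properties are isomorphism-closed, so it suffices to speak of graphs whose
   vertex sets already are disjoint. *)
definition summable_property :: "nat graph set \<Rightarrow> bool" where
  "summable_property \<P> \<longleftrightarrow>
     (\<forall>G\<in>\<P>. \<forall>H\<in>\<P>. verts G \<inter> verts H = {} \<longrightarrow> graph_union G H \<in> \<P>)"

definition far_from :: "real \<Rightarrow> nat graph set \<Rightarrow> nat graph \<Rightarrow> bool" where
  "far_from \<epsilon> \<P> G \<longleftrightarrow>
     G \<notin> \<P> \<and>
     (\<forall>H\<in>\<P>. verts H = verts G \<longrightarrow>
        \<epsilon> * real (card (edges G)) \<le>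
          real (card ((edges G - edges H) \<union> (edges H - edges G))))"


subsection \<open>Local certification\<close>

(* The vertices of an instance are its identifiers.  The polynomial p bounds the
   range of the identifiers in terms of the number of vertices. *)
definition certification_instance :: "real poly \<Rightarrow> nat graph \<Rightarrow> bool" where
  "certification_instance p G \<longleftrightarrow>
     simple_graph G \<and> connected_graph G \<and>
     (\<forall>v\<in>verts G. 1 \<le> v \<and> real v \<le> poly p (real (card (verts G))))"

type_synonym certificates = "nat \<Rightarrow> bool list"

definition proofs :: "nat graph \<Rightarrow> certificates set" where
  "proofs G = (verts G \<rightarrow>\<^sub>E UNIV)"

definition proof_size :: "nat graph \<Rightarrow> certificates \<Rightarrow> nat" where
  "proof_size G P = Max ((\<lambda>v. length (P v)) ` verts G)"

type_synonym verifier = "nat graph \<Rightarrow> certificates \<Rightarrow> nat \<Rightarrow> bool"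

definition graph_ball :: "'a graph \<Rightarrow> 'a \<Rightarrow> nat \<Rightarrow> 'a set" where
  "graph_ball G v r = {u \<in> verts G. gdist G v u \<le> enat r}"

(* Balls of an instance need not be instances, as their identifiers may be large
   compared to their size; hence all labelled graphs are considered here. *)
definition local_verifier :: "verifier \<Rightarrow> nat \<Rightarrow> bool" where
  "local_verifier A r \<longleftrightarrow>
     (\<forall>G P v. simple_graph G \<longrightarrow> P \<in> proofs G \<longrightarrow> v \<in> verts G \<longrightarrow>
        A G P v = A (induced G (graph_ball G v r)) (restrict P (graph_ball G v r)) v)"

definition approximate_pls ::
    "real poly \<Rightarrow> real \<Rightarrow> nat graph set \<Rightarrow> nat \<Rightarrow>
     (nat graph \<Rightarrow> certificates) \<Rightarrow> verifier \<Rightarrow> bool" where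
  "approximate_pls p \<epsilon> \<P> r prover A \<longleftrightarrow>
     local_verifier A r \<and>
     (\<forall>G. certification_instance p G \<and> G \<in> \<P> \<longrightarrow>
        prover G \<in> proofs G \<and> (\<forall>v\<in>verts G. A G (prover G) v)) \<and>
     (\<forall>G. certification_instance p G \<and> far_from \<epsilon> \<P> G \<longrightarrow>
        (\<forall>P\<in>proofs G. \<exists>v\<in>verts G. \<not> A G P v))"

(* There are finitely many n-vertex instances, so the supremum is a maximum; it is
   0 if there is none. *)
definition pls_complexity ::
    "real poly \<Rightarrow> nat graph set \<Rightarrow> (nat graph \<Rightarrow> certificates) \<Rightarrow> nat \<Rightarrow> nat" where
  "pls_complexity p \<P> prover n =
     (SUP G\<in>{G \<in> \<P>. certification_instance p G \<and> card (verts G) = n}.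
        proof_size G (prover G))"

end

theory Submission
  imports Defs
begin

text \<open>
  Let \<open>A\<^sub>0, \<dots>, A\<^sub>d\<close> be the colour classes of a colouring witnessing the asymptotic dimension
  for the scale \<open>2T + 1\<close>. The certificate of \<open>v\<close> lists the distances \<open>l\<^sub>i v\<close> from \<open>v\<close> to
  \<open>A\<^sub>i\<close>, truncated at \<open>T\<close>. For a threshold \<open>t < T\<close>, cut every edge leaving some
  neighbourhood \<open>{l\<^sub>i \<le> t}\<close>. A vertex of colour \<open>i\<close> lies in this neighbourhood, so its
  component after cutting does too, and hence has bounded weak diameter. Cutting preserves a
  monotone property, so the verifier may insist, for all thresholds simultaneously,
  that the component of each vertex lies in a small ball and has the property. No edge is cut for
  more than \<open>d + 1\<close> thresholds, whatever the certificates are, so some threshold cuts at most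
  \<open>(d + 1) |E| / T < \<epsilon> |E|\<close> edges; by summability the graph left over has the property.
\<close>

section \<open>Walks, distances and components\<close>

lemma walk_refl: "v \<in> verts G \<Longrightarrow> walk G v [v] v"
  by (simp add: walk_def)

lemma walk_append:
  assumes "walk G u xs v" "walk G v ys w"
  shows "walk G u (xs @ tl ys) w"
proof (cases "tl ys = []")
  case True
  then show ?thesis using assms by (cases ys) (auto simp: walk_def)
next
  case False
  then obtain y z zs where ys: "ys = y # z # zs" by (metis list.collapse tl_Nil)
  show ?thesis using assms unfolding ys
    by (auto simp: walk_def successively_append_iff)
qed

lemma walk_rev: "walk G u xs v \<Longrightarrow> walk G v (rev xs) u"
  by (auto simp: walk_def hd_rev last_rev successively_rev insert_commute)

lemma walk_mono:
  assumes "walk G u xs v" "verts G \<subseteq> verts H" "edges G \<subseteq> edges H"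
  shows "walk H u xs v"
  using assms by (auto simp: walk_def intro: successively_mono)

lemma walk_edge: "u \<in> verts G \<Longrightarrow> v \<in> verts G \<Longrightarrow> {u, v} \<in> edges G \<Longrightarrow> walk G u [u, v] v"
  by (simp add: walk_def)

lemma walk_ends: "walk G u xs v \<Longrightarrow> u \<in> verts G \<and> v \<in> verts G"
  by (auto simp: walk_def)

lemma walk_induced:
  assumes "walk G u xs v" "set xs \<subseteq> S"
  shows "walk (induced G S) u xs v"
proof -
  have "successively (\<lambda>x y. {x, y} \<in> edges (induced G S)) xs"
    using assms by (auto simp: walk_def induced_def intro: successively_mono)
  then show ?thesis using assms by (auto simp: walk_def induced_def)
qed

lemma gdist_le_iff: "gdist G u v \<le> enat n \<longleftrightarrow> (\<exists>xs. walk G u xs v \<and> length xs \<le> Suc n)"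
proof -
  \<comment> \<open>A strict bound on an infimum yields a member below it. A walk listing
    \<open>Suc n\<close> vertices has \<open>n\<close> edges.\<close>
  have "gdist G u v \<le> enat n \<longleftrightarrow> gdist G u v < enat (Suc n)"
    by (cases "gdist G u v") auto
  also have "\<dots> \<longleftrightarrow> (\<exists>xs. walk G u xs v \<and> length xs - 1 < Suc n)"
    by (simp add: gdist_def INF_less_iff)
  also have "\<dots> \<longleftrightarrow> (\<exists>xs. walk G u xs v \<and> length xs \<le> Suc n)"
    by (intro ex_cong1) auto
  finally show ?thesis .
qed

lemma gdist_triangle:
  assumes "gdist G u v \<le> enat m" "gdist G v w \<le> enat n"
  shows "gdist G u w \<le> enat (m + n)"
proof -
  obtain xs ys where "walk G u xs v" "length xs \<le> Suc m" "walk G v ys w" "length ys \<le> Suc n"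
    using assms by (auto simp: gdist_le_iff)
  then have "walk G u (xs @ tl ys) w" "length (xs @ tl ys) \<le> Suc (m + n)"
    by (auto intro: walk_append)
  then show ?thesis unfolding gdist_le_iff by blast
qed

lemma gdist_sym: "gdist G u v \<le> enat n \<Longrightarrow> gdist G v u \<le> enat n"
  unfolding gdist_le_iff by (metis length_rev walk_rev)

lemma gdist_edge:
  assumes "u \<in> verts G" "v \<in> verts G" "{u, v} \<in> edges G"
  shows "gdist G u v \<le> enat 1"
  unfolding gdist_le_iff using walk_edge[OF assms] by (intro exI[of _ "[u, v]"]) simp

lemma gdist_refl: "v \<in> verts G \<Longrightarrow> gdist G v v \<le> enat n"
  unfolding gdist_le_iff by (intro exI[of _ "[v]"]) (simp add: walk_refl)

lemma reachable_refl: "v \<in> verts G \<Longrightarrow> reachable G v v"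
  unfolding reachable_def using walk_refl by metis

lemma reachable_trans: "reachable G u v \<Longrightarrow> reachable G v w \<Longrightarrow> reachable G u w"
  unfolding reachable_def using walk_append by metis

lemma reachable_sym: "reachable G u v \<Longrightarrow> reachable G v u"
  unfolding reachable_def using walk_rev by metis

lemma reachable_edge:
  "u \<in> verts G \<Longrightarrow> v \<in> verts G \<Longrightarrow> {u, v} \<in> edges G \<Longrightarrow> reachable G u v"
  unfolding reachable_def using walk_edge by metis

lemma reachable_verts: "reachable G u v \<Longrightarrow> u \<in> verts G \<and> v \<in> verts G"
  unfolding reachable_def using walk_ends by metis

lemma reachable_mono:
  assumes "reachable G u v" "verts G \<subseteq> verts H" "edges G \<subseteq> edges H"
  shows "reachable H u v"
  using assms unfolding reachable_def by (metis walk_mono)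

lemma walk_snoc:
  assumes "walk G u (xs @ [y]) v" "xs \<noteq> []"
  shows "walk G u xs (last xs)" "v = y" "{last xs, v} \<in> edges G"
  using assms by (auto simp: walk_def successively_append_iff)

lemma reachable_induct [consumes 1, case_names refl step]:
  assumes "reachable G u v"
    and refl: "Q u"
    and step: "\<And>x y. reachable G u x \<Longrightarrow> Q x \<Longrightarrow> y \<in> verts G \<Longrightarrow> {x, y} \<in> edges G \<Longrightarrow> Q y"
  shows "Q v"
proof -
  obtain xs where "walk G u xs v" using assms(1) by (auto simp: reachable_def)
  then show ?thesis
  proof (induction xs arbitrary: v rule: rev_induct)
    case Nil
    then show ?case by (simp add: walk_def)
  next
    case (snoc y xs)
    show ?case
    proof (cases "xs = []")
      case True
      then show ?thesis using snoc.prems refl by (auto simp: walk_def)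
    next
      case False
      note w = walk_snoc[OF snoc.prems False]
      show ?thesis
        using step[of "last xs" v] w snoc.IH walk_ends[OF snoc.prems]
        by (auto simp: reachable_def)
    qed
  qed
qed

section \<open>Balls around a vertex\<close>

lemma walk_in_ball:
  assumes "walk G v xs u" "length xs \<le> Suc n"
  shows "set xs \<subseteq> graph_ball G v n"
  using assms
proof (induction xs arbitrary: u rule: rev_induct)
  case Nil
  then show ?case by simp
next
  case (snoc y xs)
  have "gdist G v u \<le> enat n" using snoc.prems by (auto simp: gdist_le_iff)
  moreover have "y = u" using snoc.prems by (simp add: walk_def)
  moreover have "u \<in> verts G" using snoc.prems walk_ends by metis
  moreover have "set xs \<subseteq> graph_ball G v n"
    using snoc walk_snoc(1)[OF snoc.prems(1)] by (cases "xs = []") auto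
  ultimately show ?case by (auto simp: graph_ball_def)
qed

lemma graph_ball_mono: "m \<le> n \<Longrightarrow> graph_ball G v m \<subseteq> graph_ball G v n"
  by (auto simp: graph_ball_def intro: order_trans)

text \<open>A walk of length at most \<open>R\<close> from the centre stays in the ball, so
  distances up to \<open>R\<close> from \<open>v\<close> survive; distances between other vertices
  may grow.\<close>

lemma graph_ball_induced_ball:
  assumes "k \<le> R"
  shows "graph_ball (induced G (graph_ball G v R)) v k = graph_ball G v k"
proof (intro equalityI subsetI)
  fix u assume "u \<in> graph_ball (induced G (graph_ball G v R)) v k"
  then obtain xs where "walk (induced G (graph_ball G v R)) v xs u" "length xs \<le> Suc k"
    by (auto simp: graph_ball_def gdist_le_iff)
  moreover from this have "walk G v xs u" by (auto elim: walk_mono simp: induced_def)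
  ultimately show "u \<in> graph_ball G v k"
    using walk_ends[of G v xs u] by (auto simp: graph_ball_def gdist_le_iff)
next
  fix u assume "u \<in> graph_ball G v k"
  then obtain xs where xs: "walk G v xs u" "length xs \<le> Suc k"
    by (auto simp: graph_ball_def gdist_le_iff)
  have "set xs \<subseteq> graph_ball G v R"
    using walk_in_ball[OF xs] graph_ball_mono[OF assms] by (rule order_trans)
  with xs(1) have "walk (induced G (graph_ball G v R)) v xs u" by (rule walk_induced)
  with xs show "u \<in> graph_ball (induced G (graph_ball G v R)) v k"
    using walk_ends[OF \<open>walk (induced G _) v xs u\<close>] by (auto simp: graph_ball_def gdist_le_iff)
qed

section \<open>Rebuilding a graph from its components\<close>

lemma finite_edges: "simple_graph G \<Longrightarrow> finite (edges G)"
  by (rule finite_subset[of _ "Pow (verts G)"]) (auto simp: simple_graph_def)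

lemma simple_edge_verts:
  assumes "simple_graph G" "{x, y} \<in> edges G"
  shows "x \<in> verts G" "y \<in> verts G"
  using assms by (auto simp: simple_graph_def)

lemma simple_edgeE:
  assumes "simple_graph G" "e \<in> edges G"
  obtains x y where "e = {x, y}" "x \<in> verts G" "y \<in> verts G"
  using assms by (force simp: simple_graph_def card_2_iff)

text \<open>Both ends of an edge lie in one component, so no edge runs between the component of
  \<open>v\<close> and those of \<open>S\<close>.\<close>

lemma induced_comp_insert:
  assumes G: "simple_graph G"
    and out: "\<not> (\<exists>w\<in>S. reachable G w v)"
  shows "induced G {u. \<exists>w\<in>insert v S. reachable G w u} =
    graph_union (induced G {u. reachable G v u}) (induced G {u. \<exists>w\<in>S. reachable G w u})"
    (is "?L = ?R")
proof -
  have "edges ?L \<subseteq> edges ?R"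
  proof
    fix e assume e: "e \<in> edges ?L"
    then have "e \<in> edges G" by (simp add: induced_def)
    then obtain x y where xy: "e = {x, y}" "x \<in> verts G" "y \<in> verts G"
      using G simple_edgeE by metis
    have "reachable G x y" using xy \<open>e \<in> edges G\<close> reachable_edge by metis
    moreover obtain w where "w \<in> insert v S" "reachable G w x"
      using e xy by (auto simp: induced_def)
    ultimately have "\<exists>w\<in>insert v S. reachable G w x \<and> reachable G w y"
      using reachable_trans by metis
    then show "e \<in> edges ?R" using xy \<open>e \<in> edges G\<close>
      by (auto simp: induced_def graph_union_def)
  qed
  moreover have "edges ?R \<subseteq> edges ?L" by (auto simp: induced_def graph_union_def)
  moreover have "verts ?L = verts ?R" by (auto simp: induced_def graph_union_def)
  ultimately show ?thesis by (intro graph.equality) auto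
qed

text \<open>Roots are added one at a time: a new root either lies in a component already covered or
  brings in a disjoint one, where summability applies. The induction starts at a single root, since
  the empty graph is not known to be in \<open>\<P>\<close>.\<close>

lemma summable_property_components:
  assumes sum: "summable_property \<P>"
    and G: "simple_graph G" "verts G \<noteq> {}"
    and comp: "\<And>v. v \<in> verts G \<Longrightarrow> induced G {u. reachable G v u} \<in> \<P>"
  shows "G \<in> \<P>"
proof -
  let ?I = "\<lambda>S. induced G {u. \<exists>w\<in>S. reachable G w u}"
  have "?I S \<in> \<P>" if "finite S" "S \<noteq> {}" "S \<subseteq> verts G" for S
    using that
  proof (induction S rule: finite_ne_induct)
    case (singleton v)
    then show ?case using comp by simp
  next
    case (insert v S)
    have IH: "?I S \<in> \<P>" using insert by simp
    show ?case
    proof (cases "\<exists>w\<in>S. reachable G w v")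
      case True
      then have "{u. \<exists>w\<in>insert v S. reachable G w u} = {u. \<exists>w\<in>S. reachable G w u}"
        by (auto intro: reachable_trans)
      then show ?thesis using IH by simp
    next
      case False
      have "verts (induced G {u. reachable G v u}) \<inter> verts (?I S) = {}"
        using False unfolding induced_def disjoint_iff
        by auto (metis reachable_trans reachable_sym)
      then show ?thesis
        using induced_comp_insert[OF G(1) False] IH comp[of v] insert.prems sum
        by (simp add: summable_property_def)
    qed
  qed
  from this[of "verts G"] have "?I (verts G) \<in> \<P>" using G by (simp add: simple_graph_def)
  moreover have "?I (verts G) = G"
  proof (rule graph.equality)
    have "{u. \<exists>w\<in>verts G. reachable G w u} = verts G"
      using reachable_verts reachable_refl by fast
    then show "edges (?I (verts G)) = edges G" "verts (?I (verts G)) = verts G"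
      using G(1) by (auto simp: induced_def simple_graph_def)
  qed simp
  ultimately show ?thesis by simp
qed

section \<open>Cutting along a threshold\<close>

text \<open>The inner end must have label exactly \<open>t\<close>, not merely at most
  \<open>t\<close>. Hence each \<open>i\<close> cuts an edge at no more than one threshold, even for
  dishonest labels. True truncated distances change by at most 1 along an edge, so for them these
  are still all edges leaving some \<open>{u. l i u \<le> t}\<close>.\<close>

definition cut_edges :: "nat \<Rightarrow> (nat \<Rightarrow> 'a \<Rightarrow> nat) \<Rightarrow> nat \<Rightarrow> 'a graph \<Rightarrow> 'a set set" where
  "cut_edges d l t G = {e \<in> edges G. \<exists>i\<le>d. \<exists>u v. e = {u, v} \<and> l i u = t \<and> t < l i v}"

definition cut_graph :: "nat \<Rightarrow> (nat \<Rightarrow> 'a \<Rightarrow> nat) \<Rightarrow> nat \<Rightarrow> 'a graph \<Rightarrow> 'a graph" where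
  "cut_graph d l t G = \<lparr>verts = verts G, edges = edges G - cut_edges d l t G\<rparr>"

lemma verts_cut_graph [simp]: "verts (cut_graph d l t G) = verts G"
  by (simp add: cut_graph_def)

lemma edges_cut_graph_subset: "edges (cut_graph d l t G) \<subseteq> edges G"
  by (auto simp: cut_graph_def)

lemma simple_cut_graph: "simple_graph G \<Longrightarrow> simple_graph (cut_graph d l t G)"
  by (auto simp: simple_graph_def cut_graph_def)

lemma simple_induced: "simple_graph G \<Longrightarrow> simple_graph (induced G S)"
  by (auto simp: simple_graph_def induced_def)

text \<open>Whether an edge is cut depends only on the labels of its own two ends.\<close>

lemma induced_cut_graph_cong:
  assumes "\<And>i u. u \<in> S \<Longrightarrow> l i u = l' i u"
  shows "induced (cut_graph d l' t (induced G S)) S = induced (cut_graph d l t G) S"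
proof (intro graph.equality)
  have "e \<in> cut_edges d l' t (induced G S) \<longleftrightarrow> e \<in> cut_edges d l t G" if "e \<subseteq> S" for e
    unfolding cut_edges_def induced_def mem_Collect_eq graph.simps
    by (intro conj_cong ex_cong1 refl) (use that assms in auto)
  then show "edges (induced (cut_graph d l' t (induced G S)) S) = edges (induced (cut_graph d l t G) S)"
    by (auto simp: induced_def cut_graph_def)
qed (auto simp: induced_def)

text \<open>Double counting: a threshold together with an edge cut there is sent to an index
  \<open>i \<le> d\<close> causing the cut, together with that edge. This map is injective.\<close>

lemma sum_card_cut_edges:
  assumes "simple_graph G"
  shows "(\<Sum>t<T. card (cut_edges d l t G)) \<le> Suc d * card (edges G)"
proof -
  let ?Q = "\<lambda>i t e. \<exists>u v. e = {u, v} \<and> l i u = t \<and> t < l i v"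
  have fin: "finite (edges G)"
    using assms by (rule finite_edges)
  have "(\<Sum>t<T. card (cut_edges d l t G)) = card (SIGMA t:{..<T}. cut_edges d l t G)"
    using fin by (intro card_SigmaI[symmetric]) (auto simp: cut_edges_def)
  also have "\<dots> \<le> card ({..d} \<times> edges G)"
  proof -
    obtain g where g: "\<And>t e. e \<in> cut_edges d l t G \<Longrightarrow> g t e \<le> d \<and> ?Q (g t e) t e"
    proof -
      have "\<forall>t e. \<exists>i. e \<in> cut_edges d l t G \<longrightarrow> i \<le> d \<and> ?Q i t e"
        by (auto simp: cut_edges_def)
      then show ?thesis using that by metis
    qed
    define f where "f = (\<lambda>(t, e). (g t e, e))"
    \<comment> \<open>The threshold is recovered from \<open>i\<close> and \<open>e\<close> as the
      smaller of the two labels \<open>l i\<close> on \<open>e\<close>.\<close>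
    have uniq: "t = t'" if "?Q i t e" "?Q i t' e" for i t t' e
      using that by (auto simp: doubleton_eq_iff)
    have "inj_on f (SIGMA t:{..<T}. cut_edges d l t G)"
    proof (rule inj_onI, clarify)
      fix t e t' e' assume e: "e \<in> cut_edges d l t G" "e' \<in> cut_edges d l t' G"
        and eq: "f (t, e) = f (t', e')"
      have "e' = e" and i: "g t' e = g t e" using eq by (auto simp: f_def)
      have "?Q (g t e) t e" using g e(1) by blast
      moreover have "?Q (g t e) t' e" using g[of e t'] e(2) unfolding \<open>e' = e\<close> i by blast
      ultimately have "t = t'" by (rule uniq)
      then show "t = t' \<and> e = e'" using \<open>e' = e\<close> by simp
    qed
    moreover have "f ` (SIGMA t:{..<T}. cut_edges d l t G) \<subseteq> {..d} \<times> edges G"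
      using g by (auto simp: f_def) (auto simp: cut_edges_def)
    ultimately show ?thesis using fin by (intro card_inj_on_le) auto
  qed
  also have "\<dots> = Suc d * card (edges G)" by (simp add: card_cartesian_product)
  finally show ?thesis .
qed

text \<open>Averaging: if all \<open>T\<close> thresholds cut at least the fraction
  \<open>\<epsilon>\<close> of the edges, the double count gives
  \<open>\<epsilon> * T \<le> Suc d\<close> after division by the positive number of edges.\<close>

lemma exists_sparse_cut:
  assumes G: "simple_graph G" and T: "real (Suc d) < \<epsilon> * real T" "\<epsilon> > 0"
    and E: "edges G \<noteq> {}"
  shows "\<exists>t<T. real (card (cut_edges d l t G)) < \<epsilon> * real (card (edges G))"
proof (rule ccontr)
  assume "\<not> ?thesis"
  then have "(\<Sum>t<T. \<epsilon> * real (card (edges G))) \<le> (\<Sum>t<T. real (card (cut_edges d l t G)))"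
    by (intro sum_mono) (use linorder_not_less in \<open>auto\<close>)
  also have "\<dots> \<le> real (Suc d * card (edges G))"
    using sum_card_cut_edges[OF G, of d l T] by (metis of_nat_le_iff of_nat_sum)
  finally have "(\<epsilon> * real T) * real (card (edges G)) \<le> real (Suc d) * real (card (edges G))"
    by (simp add: algebra_simps)
  moreover have "card (edges G) > 0"
    using E finite_edges[OF G] by (simp add: card_gt_0_iff)
  ultimately show False using T by simp
qed

section \<open>The verifier\<close>

definition accepts ::
    "'a graph set \<Rightarrow> nat \<Rightarrow> nat \<Rightarrow> nat \<Rightarrow> (nat \<Rightarrow> 'a \<Rightarrow> nat) \<Rightarrow> 'a graph \<Rightarrow> 'a \<Rightarrow> bool" where
  "accepts \<P> d T B l G v \<longleftrightarrow>
     (\<forall>t<T. let H = induced (cut_graph d l t G) (graph_ball G v (Suc B)); C = {u. reachable H v u}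
        in C \<subseteq> graph_ball G v B \<and> induced H C \<in> \<P>)"

text \<open>The cut graph is inspected only inside the ball of radius \<open>Suc B\<close>, and the
  balls of radius \<open>B\<close> and \<open>Suc B\<close> come out the same when computed in
  there.\<close>

lemma accepts_local:
  assumes "\<And>i u. u \<in> graph_ball G v (Suc B) \<Longrightarrow> l i u = l' i u"
  shows "accepts \<P> d T B l' (induced G (graph_ball G v (Suc B))) v = accepts \<P> d T B l G v"
  using induced_cut_graph_cong[of "graph_ball G v (Suc B)" l l' d _ G] assms
  by (simp add: accepts_def graph_ball_induced_ball)

text \<open>The extra layer of radius \<open>Suc B\<close> shows every edge leaving the ball of radius \<open>B\<close>, so a
  component confined to that ball is already a component of the whole cut graph.\<close>

lemma accepts_component:
  assumes G: "simple_graph G" and acc: "accepts \<P> d T B l G v" and t: "t < T"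
    and v: "v \<in> verts G"
  shows "induced (cut_graph d l t G) {u. reachable (cut_graph d l t G) v u} \<in> \<P>"
proof -
  let ?K = "cut_graph d l t G" let ?S = "graph_ball G v (Suc B)"
  let ?H = "induced ?K ?S" let ?C = "{u. reachable ?H v u}"
  have C: "?C \<subseteq> graph_ball G v B" "induced ?H ?C \<in> \<P>"
    using acc t by (auto simp: accepts_def Let_def)
  have "reachable ?H v u" if "reachable ?K v u" for u
    using that
  proof (induction rule: reachable_induct)
    case refl
    then show ?case
      using v by (auto intro!: reachable_refl gdist_refl simp: induced_def graph_ball_def)
  next
    case (step x y)
    have x: "x \<in> graph_ball G v B" using C(1) step by auto
    have e: "{x, y} \<in> edges G" using step edges_cut_graph_subset by blast
    have "gdist G x y \<le> enat 1" using e simple_edge_verts[OF G] gdist_edge by metis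
    then have "gdist G v y \<le> enat (B + 1)"
      using x by (intro gdist_triangle[of G v x]) (auto simp: graph_ball_def)
    then have "y \<in> ?S" using step by (simp add: graph_ball_def)
    moreover have "x \<in> ?S" using x graph_ball_mono[of B "Suc B" G v] by auto
    ultimately have "reachable ?H x y"
      using step e simple_edge_verts[OF G] by (intro reachable_edge) (auto simp: induced_def)
    then show ?case using step reachable_trans by metis
  qed
  moreover have "reachable ?K v u" if "reachable ?H v u" for u
    using that by (rule reachable_mono) (auto simp: induced_def)
  ultimately have eq: "{u. reachable ?K v u} = ?C" by blast
  have "?C \<subseteq> ?S" using C(1) graph_ball_mono[of B "Suc B" G v] by auto
  then have "induced ?H ?C = induced ?K ?C" by (auto simp: induced_def)
  then show ?thesis using C(2) eq by simp
qed

text \<open>The labels are arbitrary, so every dishonest proof is covered. All cut graphs have the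
  property by summability, and the one at a sparse threshold differs from \<open>G\<close> in too
  few edges.\<close>

lemma accepts_sound:
  assumes G: "simple_graph G" "verts G \<noteq> {}"
    and sum: "summable_property \<P>"
    and T: "real (Suc d) < \<epsilon> * real T" "\<epsilon> > 0"
    and acc: "\<And>v. v \<in> verts G \<Longrightarrow> accepts \<P> d T B l G v"
  shows "\<not> far_from \<epsilon> \<P> G"
proof
  assume far: "far_from \<epsilon> \<P> G"
  have cutP: "cut_graph d l t G \<in> \<P>" if "t < T" for t
    using G(2) accepts_component[OF G(1) acc that]
    by (intro summable_property_components[OF sum simple_cut_graph[OF G(1)]]) auto
  have "T > 0" using T by (cases T) auto
  \<comment> \<open>Without edges the averaging argument gives no strict inequality, but then
    cutting changes nothing and \<open>G\<close> itself has the property.\<close>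
  have "edges G \<noteq> {}"
  proof
    assume "edges G = {}"
    then have "cut_graph d l 0 G = G" by (simp add: cut_graph_def cut_edges_def)
    then show False using cutP[OF \<open>T > 0\<close>] far by (simp add: far_from_def)
  qed
  then obtain t where t: "t < T" "real (card (cut_edges d l t G)) < \<epsilon> * real (card (edges G))"
    using exists_sparse_cut[OF G(1) T] by metis
  have "(edges G - edges (cut_graph d l t G)) \<union> (edges (cut_graph d l t G) - edges G) = cut_edges d l t G"
    by (auto simp: cut_graph_def cut_edges_def)
  then show False using far cutP[OF t(1)] t(2) by (fastforce simp: far_from_def)
qed

section \<open>Truncated distances to the colour classes\<close>

text \<open>The disjunct \<open>k \<ge> T\<close> truncates at \<open>T\<close> and makes the
  minimum exist even if colour \<open>i\<close> does not occur.\<close>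

definition colour_dist :: "'a graph \<Rightarrow> ('a \<Rightarrow> nat) \<Rightarrow> nat \<Rightarrow> nat \<Rightarrow> 'a \<Rightarrow> nat" where
  "colour_dist G c T i v = (LEAST k. k \<ge> T \<or> (\<exists>a\<in>verts G. c a = i \<and> gdist G a v \<le> enat k))"

lemma colour_dist_le: "colour_dist G c T i v \<le> T"
  unfolding colour_dist_def by (rule Least_le) simp

lemma colour_dist_witness:
  assumes "colour_dist G c T i v < T"
  shows "\<exists>a\<in>verts G. c a = i \<and> gdist G a v \<le> enat (colour_dist G c T i v)"
proof -
  let ?Q = "\<lambda>k. k \<ge> T \<or> (\<exists>a\<in>verts G. c a = i \<and> gdist G a v \<le> enat k)"
  have "?Q (LEAST k. ?Q k)" by (rule LeastI[of ?Q T]) simp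
  then show ?thesis using assms by (auto simp: colour_dist_def)
qed

lemma colour_dist_bound:
  "a \<in> verts G \<Longrightarrow> c a = i \<Longrightarrow> gdist G a v \<le> enat k \<Longrightarrow> colour_dist G c T i v \<le> k"
  unfolding colour_dist_def by (rule Least_le) blast

lemma colour_dist_edge:
  assumes "x \<in> verts G" "y \<in> verts G" "{x, y} \<in> edges G"
  shows "colour_dist G c T i y \<le> Suc (colour_dist G c T i x)"
proof (cases "colour_dist G c T i x < T")
  case True
  then obtain a where "a \<in> verts G" "c a = i" "gdist G a x \<le> enat (colour_dist G c T i x)"
    using colour_dist_witness by metis
  then show ?thesis
    using gdist_triangle[of G a x _ y 1] gdist_edge[OF assms] by (simp add: colour_dist_bound)
next
  case False
  then show ?thesis using colour_dist_le[of G c T i y] by simp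
qed

text \<open>A walk in the cut graph from \<open>v\<close>, of colour \<open>i\<close>, keeps an
  invariant: the current vertex has label at most \<open>t\<close> for \<open>i\<close>, and some
  \<open>a\<close> within distance \<open>t\<close> of it lies in the monochromatic component of
  \<open>v\<close>. At the end, \<open>D\<close> bounds the way from \<open>v\<close> to
  \<open>a\<close>, and \<open>t < T\<close> the way from \<open>a\<close> to
  \<open>x\<close>.\<close>

lemma reachable_cut_close:
  assumes G: "simple_graph G" and c: "c v \<le> d" and t: "t < T"
    and reach: "reachable (cut_graph d (colour_dist G c T) t G) v x"
    and diam: "\<And>C. C \<in> monochromatic_components (graph_power G (2 * T + 1)) c \<Longrightarrow>
      weak_diameter G C \<le> enat D"
  shows "gdist G v x \<le> enat (D + T)"
proof -
  define i where "i = c v"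
  let ?l = "colour_dist G c T i"
  let ?M = "induced (graph_power G (2 * T + 1)) {v. c v = i}"
  have v: "v \<in> verts G" using reachable_verts[OF reach] by simp
  have "?l x \<le> t \<and> (\<exists>a. reachable ?M v a \<and> gdist G a x \<le> enat t)"
    using reach
  proof (induction rule: reachable_induct)
    case refl
    have "?l v \<le> 0" using v by (intro colour_dist_bound[of v] gdist_refl) (auto simp: i_def)
    moreover have "reachable ?M v v"
      using v by (intro reachable_refl) (simp add: induced_def graph_power_def i_def)
    ultimately show ?case using gdist_refl[OF v] by auto
  next
    case (step x y)
    then obtain a where a: "reachable ?M v a" "gdist G a x \<le> enat t" and lx: "?l x \<le> t" by blast
    have e: "{x, y} \<in> edges G" and ncut: "{x, y} \<notin> cut_edges d (colour_dist G c T) t G"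
      using step by (auto simp: cut_graph_def)
    note xy = simple_edge_verts[OF G e]
    \<comment> \<open>The label grows by at most 1, so exceeding \<open>t\<close> forces
      \<open>?l x = t\<close>, and then the edge would have been cut.\<close>
    have ly: "?l y \<le> t"
    proof (rule ccontr)
      assume "\<not> ?l y \<le> t"
      then have "?l x = t" "t < ?l y" using colour_dist_edge[OF xy e, of c T i] lx by auto
      then show False using ncut e c by (auto simp: cut_edges_def i_def)
    qed
    then obtain b where b: "b \<in> verts G" "c b = i" "gdist G b y \<le> enat (?l y)"
      using colour_dist_witness t by (metis le_less_trans)
    then have by': "gdist G b y \<le> enat t" using ly by (meson enat_ord_simps(1) order_trans)
    \<comment> \<open>The route \<open>a\<close>, \<open>x\<close>, \<open>y\<close>,
      \<open>b\<close> explains the power \<open>2 * T + 1\<close>: in it, \<open>a\<close> and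
      \<open>b\<close> are equal or adjacent.\<close>
    have "gdist G a b \<le> enat (t + 1 + t)"
      using gdist_triangle[OF gdist_triangle[OF a(2) gdist_edge[OF xy e]] gdist_sym[OF by']] .
    also have "\<dots> \<le> enat (2 * T + 1)" using t by simp
    finally have ab: "gdist G a b \<le> enat (2 * T + 1)" .
    have a': "a \<in> verts G" "c a = i"
      using reachable_verts[OF a(1)] by (auto simp: induced_def graph_power_def)
    have "reachable ?M a b"
    proof (cases "a = b")
      case True
      then show ?thesis using reachable_verts[OF a(1)] reachable_refl by metis
    next
      case False
      then show ?thesis using a' b ab
        by (intro reachable_edge) (auto simp: induced_def graph_power_def)
    qed
    then show ?case using ly by' a(1) reachable_trans by metis
  qed
  then obtain a where a: "reachable ?M v a" "gdist G a x \<le> enat t" by blast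
  let ?C = "{u. reachable ?M v u}"
  have vM: "v \<in> verts ?M" using reachable_verts[OF a(1)] by simp
  then have "?C \<in> monochromatic_components (graph_power G (2 * T + 1)) c"
    unfolding monochromatic_components_def components_of_def by blast
  then have "weak_diameter G ?C \<le> enat D" by (rule diam)
  moreover have "gdist G v a \<le> weak_diameter G ?C"
    unfolding weak_diameter_def
    using a(1) reachable_refl[OF vM] by (intro SUP_upper2[of v] SUP_upper2[of a]) auto
  ultimately have "gdist G v a \<le> enat D" by (rule order_trans[rotated])
  from gdist_triangle[OF this a(2)] have "gdist G v x \<le> enat (D + t)" .
  also have "\<dots> \<le> enat (D + T)" using t by simp
  finally show ?thesis .
qed

text \<open>Components stay within \<open>D + T\<close> by \<open>reachable_cut_close\<close> and
  are subgraphs of \<open>G\<close>, so monotonicity applies. Labels need to agree only where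
  decoding is faithful.\<close>

lemma accepts_complete:
  assumes G: "simple_graph G" "G \<in> \<P>" and mono: "monotone_property \<P>"
    and v: "v \<in> verts G" "c v \<le> d"
    and diam: "\<And>C. C \<in> monochromatic_components (graph_power G (2 * T + 1)) c \<Longrightarrow>
      weak_diameter G C \<le> enat D"
    and l: "\<And>i u. i \<le> d \<Longrightarrow> u \<in> verts G \<Longrightarrow> l i u = colour_dist G c T i u"
  shows "accepts \<P> d T (D + T) l G v"
  unfolding accepts_def Let_def
proof (intro allI impI conjI)
  fix t assume t: "t < T"
  let ?K = "cut_graph d (colour_dist G c T) t G"
  let ?H = "induced (cut_graph d l t G) (graph_ball G v (Suc (D + T)))"
  let ?C = "{u. reachable ?H v u}"
  have "cut_edges d l t G = cut_edges d (colour_dist G c T) t G"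
    unfolding cut_edges_def using l simple_edge_verts[OF G(1)] by (auto; metis)
  then have K: "cut_graph d l t G = ?K" by (simp add: cut_graph_def)
  show "?C \<subseteq> graph_ball G v (D + T)"
  proof
    fix u assume "u \<in> ?C"
    then have "reachable ?K v u"
      unfolding K mem_Collect_eq by (rule reachable_mono) (auto simp: induced_def)
    then show "u \<in> graph_ball G v (D + T)"
      using reachable_cut_close[where x = u, OF G(1) v(2) t \<open>reachable ?K v u\<close>]
        diam reachable_verts[of ?K v u]
      by (simp add: graph_ball_def)
  qed
  have "subgraph (induced ?H ?C) G"
    unfolding subgraph_def
  proof (intro conjI)
    show "simple_graph (induced ?H ?C)" by (intro simple_induced simple_cut_graph G(1))
  qed (auto simp: induced_def cut_graph_def)
  then show "induced ?H ?C \<in> \<P>" using mono G(2) by (auto simp: monotone_property_def)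
qed

section \<open>Constant-size certificates\<close>

text \<open>On a list of the wrong length, \<open>decode\<close> reads junk values of \<open>!\<close>; this is harmless, since
  \<open>accepts_sound\<close> holds for arbitrary labels.\<close>

definition encode :: "nat \<Rightarrow> nat \<Rightarrow> (nat \<Rightarrow> nat) \<Rightarrow> bool list" where
  "encode d T f = map (\<lambda>k. k mod T < f (k div T)) [0..<Suc d * T]"

definition decode :: "nat \<Rightarrow> nat \<Rightarrow> bool list \<Rightarrow> nat" where
  "decode T i bs = card {k. k < T \<and> bs ! (i * T + k)}"

lemma length_encode: "length (encode d T f) = Suc d * T"
  unfolding encode_def by simp

text \<open>Label \<open>i\<close> is stored in unary in the \<open>T\<close> bits from position
  \<open>i * T\<close> on: the first \<open>f i\<close> of them are set, and counting recovers
  \<open>f i\<close>.\<close>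

lemma decode_encode:
  assumes "i \<le> d" "f i \<le> T"
  shows "decode T i (encode d T f) = f i"
proof -
  have "encode d T f ! (i * T + k) \<longleftrightarrow> k < f i" if "k < T" for k
  proof -
    have "i * T + k < Suc i * T" using that by simp
    also have "\<dots> \<le> Suc d * T" using assms(1) by (intro mult_right_mono) auto
    finally show ?thesis using that unfolding encode_def by (simp del: mult_Suc)
  qed
  then have "{k. k < T \<and> encode d T f ! (i * T + k)} = {..<f i}" using assms(2) by auto
  then show ?thesis by (simp add: decode_def)
qed

section \<open>Assembling the scheme\<close>

theorem theorem5:
  fixes \<epsilon> :: real and p :: "real poly" and \<G> \<P> :: "nat graph set"
  assumes "\<epsilon> > 0"
    and "graph_class \<G>"
    and "bounded_asymptotic_dim \<G>"
    and "graph_property \<P> \<G>"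
    and "monotone_property \<P>"
    and "summable_property \<P>"
  shows "\<exists>r K :: nat. \<exists>prover A.
           approximate_pls p \<epsilon> \<P> r prover A \<and> (\<forall>n. pls_complexity p \<P> prover n \<le> K)"
proof -
  obtain d D where dD: "\<And>r G. r \<ge> 1 \<Longrightarrow> G \<in> \<G> \<Longrightarrow>
      \<exists>c. c ` verts G \<subseteq> {..<d + 1} \<and>
        (\<forall>C\<in>monochromatic_components (graph_power G r) c. weak_diameter G C \<le> enat (D r))"
    using assms(3) unfolding bounded_asymptotic_dim_def asymptotic_dim_at_most_def by metis
  \<comment> \<open>So many thresholds make the average fraction of cut edges, at most
    \<open>Suc d / T\<close>, smaller than \<open>\<epsilon>\<close>.\<close>
  obtain T :: nat where "real (Suc d) / \<epsilon> < real T" using reals_Archimedean2 by blast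
  then have T: "real (Suc d) < \<epsilon> * real T"
    using assms(1) by (simp add: divide_less_eq mult.commute)
  define B where "B = D (2 * T + 1) + T"
  \<comment> \<open>The prover is a function of the graph, so one colouring is fixed for every
    member of the class at once.\<close>
  have "\<exists>c. \<forall>G\<in>\<G>. c G ` verts G \<subseteq> {..<d + 1} \<and>
        (\<forall>C\<in>monochromatic_components (graph_power G (2 * T + 1)) (c G).
          weak_diameter G C \<le> enat (D (2 * T + 1)))"
    using dD[of "2 * T + 1"] by (intro bchoice) simp
  then obtain c where c: "\<And>G. G \<in> \<G> \<Longrightarrow> c G ` verts G \<subseteq> {..<d + 1}"
    and diam: "\<And>G C. G \<in> \<G> \<Longrightarrow> C \<in> monochromatic_components (graph_power G (2 * T + 1)) (c G) \<Longrightarrow>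
      weak_diameter G C \<le> enat (D (2 * T + 1))"
    by metis
  define prover :: "nat graph \<Rightarrow> certificates" where
    "prover G = (\<lambda>v\<in>verts G. encode d T (\<lambda>i. colour_dist G (c G) T i v))" for G
  define A :: verifier where
    "A G P v \<longleftrightarrow> accepts \<P> d T B (\<lambda>i u. decode T i (P u)) G v" for G P v
  have "local_verifier A (Suc B)"
    unfolding local_verifier_def A_def
    by (intro allI impI accepts_local[symmetric]) (simp add: restrict_def)
  moreover have "prover G \<in> proofs G \<and> (\<forall>v\<in>verts G. A G (prover G) v)" if "G \<in> \<P>" for G
  proof -
    have G: "G \<in> \<G>" "simple_graph G"
      using that assms(2,4) by (auto simp: graph_class_def graph_property_def)
    have "A G (prover G) v" if v: "v \<in> verts G" for v
      unfolding A_def B_def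
    proof (rule accepts_complete[OF G(2) \<open>G \<in> \<P>\<close> assms(5) v _ diam[OF G(1)]])
      show "c G v \<le> d" using c[OF G(1)] v by auto
      show "decode T i (prover G u) = colour_dist G (c G) T i u" if "i \<le> d" "u \<in> verts G" for i u
        using that by (simp add: prover_def decode_encode colour_dist_le)
    qed
    then show ?thesis by (auto simp: prover_def proofs_def)
  qed
  moreover have "\<exists>v\<in>verts G. \<not> A G P v"
    if "certification_instance p G" "far_from \<epsilon> \<P> G" for G P
    using accepts_sound[OF _ _ assms(6) T assms(1)] that
    unfolding A_def certification_instance_def connected_graph_def by blast
  ultimately have "approximate_pls p \<epsilon> \<P> (Suc B) prover A"
    unfolding approximate_pls_def by blast
  moreover have "pls_complexity p \<P> prover n \<le> Suc d * T" for n
  proof -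
    have "proof_size G (prover G) \<le> Suc d * T" if "certification_instance p G" for G
    proof -
      have "finite (verts G)" "verts G \<noteq> {}"
        using that by (auto simp: certification_instance_def simple_graph_def connected_graph_def)
      then show ?thesis
        unfolding proof_size_def by (intro Max.boundedI) (auto simp: prover_def length_encode)
    qed
    note size = this
    show ?thesis
    proof (cases "{G \<in> \<P>. certification_instance p G \<and> card (verts G) = n} = {}")
      case True
      \<comment> \<open>The supremum of the empty set of naturals is 0.\<close>
      then show ?thesis unfolding pls_complexity_def True by (simp add: Sup_nat_def)
    next
      case False
      then show ?thesis unfolding pls_complexity_def by (rule cSUP_least) (use size in blast)
    qed
  qed
  ultimately show ?thesis by blast
qed

end
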